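(* The set of all Besicovitch functions belonging to $C(\lambda)$ is a meager set (i.e. a set of first category) in the metric space $(C(\lambda),\rho)$.
   Context: Let $I=[0,1]$, let $\lambda$ be the Lebesgue measure on $I$, and let $\mathcal B$ be the Borel sets of $I$. $C(\lambda)$ denotes the set of all continuous functions $f$ from $I$ onto $I$ that preserve $\lambda$, i.e. $\lambda(A)=\lambda(f^{-1}(A))$ for all $A\in\mathcal B$. It is endowed with the uniform metric $\rho(f,g)=\sup_{x\in I}|f(x)-g(x)|$. The Dini derivatives of $f$ at $t\in I$ are $D^{+}f(t)=\limsup_{x\to t^{+},\,x\in I}\frac{f(x)-f(t)}{x-t}$, $D_{+}f(t)=\liminf_{x\to t^{+},\,x\in I}\frac{f(x)-f(t)}{x-t}$, $D^{-}f(t)=\limsup_{x\to t^{-},\,x\in I}\frac{f(x)-f(t)}{x-t}$, $D_{-}f(t)=\liminf_{x\to t^{-},\,x\in I}\frac{f(x)-f(t)}{x-t}$, with values in $\mathbb R\cup\{\pm\infty\}$. A finite or infinite right derivative exists at $t$ if $D^+f(t)=D_+f(t)\in\mathbb R\cup\{\pm\infty\}$; a finite or infinite left derivative exists at $t$ if $D^-f(t)=D_-f(t)\in\mathbb R\cup\{\pm\infty\}$. A Besicovitch function is a continuous function $f\colon I\to\mathbb R$ such that for every $t\in I$ there is neither a finite or infinite right derivative nor a finite or infinite left derivative at $t$ (at $t=0$ only the right derivative, and at $t=1$ only the left derivative, is considered). *)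

theory Defs
  imports "HOL-Analysis.Analysis"
begin

abbreviation unit_I :: "real set" where
  "unit_I \<equiv> {0..1}"

text \<open>Functions on \<open>unit_I\<close> are represented by total functions of type \<open>real \<Rightarrow> real\<close>
  that are \<open>undefined\<close> outside \<open>unit_I\<close>, so that equality of representatives is equality
  of functions on \<open>unit_I\<close> and the uniform distance really is a metric.\<close>

definition C_lambda :: "(real \<Rightarrow> real) set" where
  "C_lambda = {f \<in> extensional unit_I. continuous_on unit_I f \<and> f ` unit_I = unit_I \<and>
     (\<forall>A \<in> sets borel. A \<subseteq> unit_I \<longrightarrow>
        emeasure lborel A = emeasure lborel {x \<in> unit_I. f x \<in> A})}"

definition C_lambda_metric :: "(real \<Rightarrow> real) metric" where
  "C_lambda_metric = submetric (cfunspace (top_of_set unit_I) euclidean_metric) C_lambda"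

lemma mspace_C_lambda_metric: "mspace C_lambda_metric = C_lambda"
proof -
  have "f \<in> mspace (cfunspace (top_of_set unit_I) euclidean_metric)" if "f \<in> C_lambda" for f
    using that by (auto simp: C_lambda_def Met_TC.mbounded_def subset_iff
        intro!: exI[of _ 0] exI[of _ 1])
  then show ?thesis
    by (auto simp: C_lambda_metric_def)
qed

lemma mdist_C_lambda_metric:
  assumes "f \<in> C_lambda" "g \<in> C_lambda"
  shows "mdist C_lambda_metric f g = (SUP x \<in> unit_I. \<bar>f x - g x\<bar>)"
proof -
  have "f \<in> mspace C_lambda_metric" "g \<in> mspace C_lambda_metric"
    using assms by (simp_all add: mspace_C_lambda_metric)
  then have "f \<in> Metric_space.fspace UNIV dist unit_I" "g \<in> Metric_space.fspace UNIV dist unit_I"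
    by (auto simp: C_lambda_metric_def Met_TC.fspace_def)
  then show ?thesis
    by (simp add: C_lambda_metric_def mdist_cfunspace_eq_mdist_funspace Met_TC.fdist_def dist_real_def)
qed

definition diff_quotient :: "(real \<Rightarrow> real) \<Rightarrow> real \<Rightarrow> real \<Rightarrow> ereal" where
  "diff_quotient f t x = ereal ((f x - f t) / (x - t))"

definition Dini_upper_right :: "(real \<Rightarrow> real) \<Rightarrow> real \<Rightarrow> ereal" where
  "Dini_upper_right f t = Limsup (at t within (unit_I \<inter> {t<..})) (diff_quotient f t)"

definition Dini_lower_right :: "(real \<Rightarrow> real) \<Rightarrow> real \<Rightarrow> ereal" where
  "Dini_lower_right f t = Liminf (at t within (unit_I \<inter> {t<..})) (diff_quotient f t)"

definition Dini_upper_left :: "(real \<Rightarrow> real) \<Rightarrow> real \<Rightarrow> ereal" where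
  "Dini_upper_left f t = Limsup (at t within (unit_I \<inter> {..<t})) (diff_quotient f t)"

definition Dini_lower_left :: "(real \<Rightarrow> real) \<Rightarrow> real \<Rightarrow> ereal" where
  "Dini_lower_left f t = Liminf (at t within (unit_I \<inter> {..<t})) (diff_quotient f t)"

definition has_right_derivative :: "(real \<Rightarrow> real) \<Rightarrow> real \<Rightarrow> bool" where
  "has_right_derivative f t \<longleftrightarrow> Dini_upper_right f t = Dini_lower_right f t"

definition has_left_derivative :: "(real \<Rightarrow> real) \<Rightarrow> real \<Rightarrow> bool" where
  "has_left_derivative f t \<longleftrightarrow> Dini_upper_left f t = Dini_lower_left f t"

definition Besicovitch :: "(real \<Rightarrow> real) \<Rightarrow> bool" where
  "Besicovitch f \<longleftrightarrow> continuous_on unit_I f \<and>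
     (\<forall>t \<in> {0..<1}. \<not> has_right_derivative f t) \<and>
     (\<forall>t \<in> {0<..1}. \<not> has_left_derivative f t)"

definition nowhere_dense_in :: "'a topology \<Rightarrow> 'a set \<Rightarrow> bool" where
  "nowhere_dense_in X A \<longleftrightarrow> A \<subseteq> topspace X \<and> X interior_of (X closure_of A) = {}"

definition meager_in :: "'a topology \<Rightarrow> 'a set \<Rightarrow> bool" where
  "meager_in X S \<longleftrightarrow> (\<exists>\<F>. countable \<F> \<and> (\<forall>A \<in> \<F>. nowhere_dense_in X A) \<and> S = \<Union>\<F>)"

end

theory Submission
  imports Defs
begin

text \<open>A typical function \<open>f\<close> in \<open>C_lambda\<close> has a point with right derivative \<open>\<infinity>\<close> and so is not a
  Besicovitch function. Such a point is obtained as the limit of a nested construction. At stage \<open>n\<close> there are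
  \<open>a < c < b\<close> such that all chords from \<open>a\<close> to points of \<open>{c..b}\<close> have slope greater than \<open>n\<close>; at the next stage
  one has such a triple for \<open>n + 1\<close> in \<open>{a..c}\<close>, while all chords that bridge the two scales still have
  slope greater than \<open>n\<close> (\<open>refines\<close>). If the construction never stops, then the triples shrink to a point
  whose difference quotients from the right tend to \<open>\<infinity>\<close> (\<open>has_right_derivative_at_nested\<close>).

  The conditions on a triple are strict inequalities on compact sets, hence open in the uniform metric
  (\<open>openin_steeper_on\<close>). They can be achieved by arbitrarily small perturbations: to the right of the last minimiser
  of \<open>f - n x\<close> one composes \<open>f\<close> with a piecewise affine zigzag of a tiny window that preserves Lebesgue
  measure and has a very short last lap. This keeps \<open>f\<close> in \<open>C_lambda\<close>, moves it by no more than its oscillation on the window,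
  and makes it arbitrarily steep on that lap (\<open>refinable_dense\<close>). So for each triple the functions at which the
  construction stops there form a nowhere dense set (\<open>nowhere_dense_unrefinable\<close>).

  With rational end points there are only countably many triples. A Besicovitch function in \<open>C_lambda\<close> has a first triple,
  for slope 0, as it is different from \<open>1 - x\<close> (\<open>Besicovitch_rises\<close>), and the construction
  has to stop at some stage. Hence all these functions lie in a countable union of nowhere dense sets.\<close>

section \<open>A measure-preserving zigzag\<close>

text \<open>A continuous \<open>\<lambda>\<close>-preserving map that is the identity off the window from \<open>p\<close> to \<open>q\<close> and runs
  three times across the window: up and down again, with equal slopes, between \<open>p\<close> and \<open>u\<close>, and
  once more up between \<open>u\<close> and \<open>q\<close>. It is written as one closed formula on the whole line so that
  continuity is immediate; the first and the last summand produce the identity on the two sides.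
  The purpose of the map is that a function composed with it makes its complete journey from its
  value at \<open>p\<close> to its value at \<open>q\<close> within the last lap, which may be as short as desired.\<close>

definition zigzag :: "real \<Rightarrow> real \<Rightarrow> real \<Rightarrow> real \<Rightarrow> real" where
  "zigzag p u q x = min x p
     + (q - p) * (max 0 (1 - \<bar>x - (p + u) / 2\<bar> / ((u - p) / 2)) + min 1 (max 0 ((x - u) / (q - u))))
     + max 0 (x - q)"

lemma continuous_on_zigzag: "p < u \<Longrightarrow> u < q \<Longrightarrow> continuous_on S (zigzag p u q)"
  unfolding zigzag_def by (intro continuous_intros) auto

lemma zigzag_cases:
  assumes "p < u" "u < q"
  shows "x \<notin> {p..<q} \<Longrightarrow> zigzag p u q x = x"
    and "x \<in> {p..<(p + u) / 2} \<Longrightarrow> zigzag p u q x = p + (x - p) * (q - p) / ((u - p) / 2)"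
    and "x \<in> {(p + u) / 2..<u} \<Longrightarrow> zigzag p u q x = p + (u - x) * (q - p) / ((u - p) / 2)"
    and "x \<in> {u..<q} \<Longrightarrow> zigzag p u q x = p + (x - u) * (q - p) / (q - u)"
proof -
  have t1: "\<bar>x - (p + u) / 2\<bar> / ((u - p) / 2) \<ge> 1" if "x \<le> p \<or> x \<ge> u"
    using that assms by (auto simp: field_simps abs_if)
  have t2: "(x - u) / (q - u) \<le> 0" if "x \<le> u"
    using that assms by (simp add: divide_nonpos_pos)
  have t3: "(x - u) / (q - u) \<ge> 0" if "u \<le> x"
    using that assms by simp
  have t4: "(x - u) / (q - u) \<ge> 1" if "q \<le> x"
    using that assms by (simp add: field_simps)
  have t5: "(x - u) / (q - u) \<le> 1" if "x \<le> q"
    using that assms by (simp add: field_simps)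
  have t6: "\<bar>x - (p + u) / 2\<bar> / ((u - p) / 2) \<le> 1" if "p \<le> x" "x \<le> u"
    using that assms by (auto simp: field_simps abs_if)
  show "zigzag p u q x = x" if "x \<notin> {p..<q}"
    using that assms t1 t2 t4 by (cases "x < p") (auto simp: zigzag_def)
  show "zigzag p u q x = p + (x - p) * (q - p) / ((u - p) / 2)" if "x \<in> {p..<(p + u) / 2}"
  proof -
    have "1 - \<bar>x - (p + u) / 2\<bar> / ((u - p) / 2) = (x - p) / ((u - p) / 2)"
      using that assms by (auto simp: field_simps abs_if)
    moreover have "x \<le> u" using that assms by auto
    ultimately show ?thesis
      using that assms t2 t6 by (auto simp: zigzag_def max_def min_def)
  qed
  show "zigzag p u q x = p + (u - x) * (q - p) / ((u - p) / 2)" if "x \<in> {(p + u) / 2..<u}"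
  proof -
    have "1 - \<bar>x - (p + u) / 2\<bar> / ((u - p) / 2) = (u - x) / ((u - p) / 2)"
      using that assms by (auto simp: field_simps abs_if)
    moreover have "x \<ge> p" using that assms by auto
    ultimately show ?thesis
      using that assms t2 t6 by (auto simp: zigzag_def max_def min_def)
  qed
  show "zigzag p u q x = p + (x - u) * (q - p) / (q - u)" if "x \<in> {u..<q}"
    using that assms t1 t3 t5 by (auto simp: zigzag_def max_def min_def)
qed

lemma zigzag_in_window:
  assumes "p < u" "u < q" "x \<in> {p..q}"
  shows "zigzag p u q x \<in> {p..q}"
proof -
  have in_window: "p + y * (q - p) / l \<in> {p..q}" if "0 \<le> y" "y \<le> l" "0 < l" for y l
  proof -
    have "0 \<le> y / l" "y / l \<le> 1" using that by simp_all
    then have "0 \<le> (q - p) * (y / l)" "(q - p) * (y / l) \<le> q - p"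
      using assms mult_nonneg_nonneg[of "q - p" "y / l"] mult_left_le[of "y / l" "q - p"]
      by simp_all
    then show ?thesis by (simp add: mult.commute)
  qed
  consider "x = q" | "x \<in> {p..<(p + u) / 2}" | "x \<in> {(p + u) / 2..<u}" | "x \<in> {u..<q}"
    using assms by fastforce
  then show ?thesis
  proof cases
    case 1
    then show ?thesis using zigzag_cases(1)[of p u q x] assms by auto
  next
    case 2
    then show ?thesis unfolding zigzag_cases(2)[OF assms(1,2) 2] by (intro in_window) auto
  next
    case 3
    then show ?thesis unfolding zigzag_cases(3)[OF assms(1,2) 3] using assms by (intro in_window) auto
  next
    case 4
    then show ?thesis unfolding zigzag_cases(4)[OF assms(1,2) 4] by (intro in_window) auto
  qed
qed

lemma emeasure_lborel_affine_vimage: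
  fixes c d :: real
  assumes "S \<in> sets borel" "c \<noteq> 0"
  shows "emeasure lborel {x. d + c * x \<in> S} = ennreal (1 / \<bar>c\<bar>) * emeasure lborel S"
proof -
  have "emeasure lborel S = emeasure (density (distr lborel borel (\<lambda>x. d + c * x)) (\<lambda>_. \<bar>c\<bar>)) S"
    using lborel_real_affine[OF assms(2), of d] by simp
  also have "\<dots> = ennreal \<bar>c\<bar> * emeasure lborel {x. d + c * x \<in> S}"
    using assms by (subst emeasure_density)
      (auto simp: nn_integral_cmult emeasure_distr vimage_def)
  finally show ?thesis
    using assms(2)
    by (simp add: mult.assoc[symmetric] ennreal_mult[symmetric])
qed

text \<open>On each lap the map is affine and onto the window, so the part of the preimage in that lap has
  the measure of the target multiplied by the length of the lap relative to the window. The relative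
  lengths of the three laps add up to 1. Half-open laps make the decomposition disjoint; the
  decreasing lap then sees the window without its left instead of its right end, which does not
  affect the measure.\<close>

lemma emeasure_lborel_zigzag_vimage:
  assumes "p < u" "u < q" and S: "S \<in> sets borel"
  shows "emeasure lborel {x. zigzag p u q x \<in> S} = emeasure lborel S"
proof -
  define h where "h = (u - p) / 2"
  have h: "h > 0" "u = p + 2 * h" "(p + u) / 2 = p + h" "(u - p) / 2 = h"
    using assms by (auto simp: h_def field_simps)
  have pq: "p < q" using assms by simp
  define m where "m = emeasure lborel (S \<inter> {p..<q})"
  have m': "emeasure lborel (S \<inter> {p<..q}) = m"
    unfolding m_def using AE_lborel_singleton[of p] AE_lborel_singleton[of q] S
    by (intro emeasure_eq_AE) auto
  define c1 c3 where "c1 = (q - p) / h" and "c3 = (q - p) / (q - u)"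
  have c: "c1 > 0" "c3 > 0" using h assms pq by (auto simp: c1_def c3_def)
  have c1: "c1 * (p + h) = c1 * p + (q - p)" "c1 * (p + 2 * h) = c1 * p + 2 * (q - p)"
    using h by (simp_all add: c1_def distrib_left)
  have c3: "c3 * q = c3 * u + (q - p)"
  proof -
    have "c3 * (q - u) = q - p" using assms by (simp add: c3_def)
    then show ?thesis by (simp add: right_diff_distrib)
  qed
  define E0 E1 E2 E3 where "E0 = S - {p..<q}"
    and "E1 = {x \<in> {p..<p + h}. zigzag p u q x \<in> S}"
    and "E2 = {x \<in> {p + h..<u}. zigzag p u q x \<in> S}"
    and "E3 = {x \<in> {u..<q}. zigzag p u q x \<in> S}"
  note z = zigzag_cases[OF assms(1,2), unfolded h(3,4)]
  have E1: "E1 = {x. (p - c1 * p) + c1 * x \<in> S \<inter> {p..<q}}"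
  proof -
    have "x \<in> {p..<p + h} \<longleftrightarrow> (p - c1 * p) + c1 * x \<in> {p..<q}" for x
    proof -
      have "x \<in> {p..<p + h} \<longleftrightarrow> c1 * p \<le> c1 * x \<and> c1 * x < c1 * (p + h)"
        using c by simp
      also have "\<dots> \<longleftrightarrow> (p - c1 * p) + c1 * x \<in> {p..<q}"
        unfolding c1 by auto
      finally show ?thesis .
    qed
    moreover have "zigzag p u q x = (p - c1 * p) + c1 * x" if "x \<in> {p..<p + h}" for x
      unfolding z(2)[OF that] c1_def using h(1) assms by (simp add: algebra_simps diff_divide_distrib add_divide_distrib)
    ultimately show ?thesis unfolding E1_def by auto
  qed
  have E2: "E2 = {x. (p + c1 * u) + (- c1) * x \<in> S \<inter> {p<..q}}"
  proof -
    have "x \<in> {p + h..<u} \<longleftrightarrow> (p + c1 * u) + (- c1) * x \<in> {p<..q}" for x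
    proof -
      have "x \<in> {p + h..<u} \<longleftrightarrow> c1 * (p + h) \<le> c1 * x \<and> c1 * x < c1 * u"
        using c by simp
      also have "\<dots> \<longleftrightarrow> (p + c1 * u) + (- c1) * x \<in> {p<..q}"
        unfolding c1 h(2) by auto
      finally show ?thesis .
    qed
    moreover have "zigzag p u q x = (p + c1 * u) + (- c1) * x" if "x \<in> {p + h..<u}" for x
      unfolding z(3)[OF that] c1_def using h(1) assms by (simp add: algebra_simps diff_divide_distrib add_divide_distrib)
    ultimately show ?thesis unfolding E2_def by auto
  qed
  have E3: "E3 = {x. (p - c3 * u) + c3 * x \<in> S \<inter> {p..<q}}"
  proof -
    have "x \<in> {u..<q} \<longleftrightarrow> (p - c3 * u) + c3 * x \<in> {p..<q}" for x
    proof -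
      have "x \<in> {u..<q} \<longleftrightarrow> c3 * u \<le> c3 * x \<and> c3 * x < c3 * q"
        using c by simp
      also have "\<dots> \<longleftrightarrow> (p - c3 * u) + c3 * x \<in> {p..<q}"
        unfolding c3 by auto
      finally show ?thesis .
    qed
    moreover have "zigzag p u q x = (p - c3 * u) + c3 * x" if "x \<in> {u..<q}" for x
      unfolding z(4)[OF that] c3_def using h(1) assms by (simp add: algebra_simps diff_divide_distrib add_divide_distrib)
    ultimately show ?thesis unfolding E3_def by auto
  qed
  have Z[measurable]: "zigzag p u q \<in> borel_measurable borel"
    using continuous_on_zigzag[OF assms(1,2)] by (rule borel_measurable_continuous_onI)
  have sets[measurable]: "E0 \<in> sets borel" "E1 \<in> sets borel" "E2 \<in> sets borel" "E3 \<in> sets borel"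
    using S unfolding E0_def E1_def E2_def E3_def by measurable
  have "{x. zigzag p u q x \<in> S} = E0 \<union> (E1 \<union> (E2 \<union> E3))"
    (is "_ = ?U")
  proof -
    have "zigzag p u q x \<in> S \<longleftrightarrow> x \<in> ?U" for x
    proof -
      consider "x \<notin> {p..<q}" | "x \<in> {p..<p + h}" | "x \<in> {p + h..<u}" | "x \<in> {u..<q}"
        by fastforce
      then show ?thesis
      proof cases
        case 1
        have "x \<notin> {p..<p + h}" "x \<notin> {p + h..<u}" "x \<notin> {u..<q}"
          using 1 assms h by auto
        then show ?thesis
          using 1 z(1)[OF 1] by (auto simp: E0_def E1_def E2_def E3_def)
      qed (use assms h in \<open>simp_all add: E0_def E1_def E2_def E3_def\<close>)
    qed
    then show ?thesis by blast
  qed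
  then have "emeasure lborel {x. zigzag p u q x \<in> S}
      = emeasure lborel (E0 \<union> (E1 \<union> (E2 \<union> E3)))" by simp
  also have "\<dots> = emeasure lborel E0 + (emeasure lborel E1 + (emeasure lborel E2 + emeasure lborel E3))"
    (is "_ = ?R")
  proof -
    have "E2 \<inter> E3 = {}" by (auto simp: E2_def E3_def)
    moreover have "E1 \<inter> (E2 \<union> E3) = {}" using h by (auto simp: E1_def E2_def E3_def)
    moreover have "E0 \<inter> (E1 \<union> (E2 \<union> E3)) = {}"
      using h assms by (auto simp: E0_def E1_def E2_def E3_def)
    ultimately show ?thesis by (simp add: plus_emeasure[symmetric] sets.Un)
  qed
  also have "emeasure lborel E1 = ennreal (1 / c1) * m"
    using S c unfolding E1 m_def by (subst emeasure_lborel_affine_vimage) auto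
  also have "emeasure lborel E2 = ennreal (1 / c1) * m"
    using S c unfolding E2 m'[symmetric] by (subst emeasure_lborel_affine_vimage) auto
  also have "emeasure lborel E3 = ennreal (1 / c3) * m"
    using S c unfolding E3 m_def by (subst emeasure_lborel_affine_vimage) auto
  also have "ennreal (1 / c1) * m + (ennreal (1 / c1) * m + ennreal (1 / c3) * m)
      = ennreal (1 / c1 + (1 / c1 + 1 / c3)) * m"
  proof -
    have "ennreal (1 / c1 + (1 / c1 + 1 / c3)) = ennreal (1 / c1) + ennreal (1 / c1 + 1 / c3)"
      using c by (intro ennreal_plus) auto
    also have "ennreal (1 / c1 + 1 / c3) = ennreal (1 / c1) + ennreal (1 / c3)"
      using c by (intro ennreal_plus) auto
    finally show ?thesis by (simp only: distrib_right)
  qed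
  also have "1 / c1 + (1 / c1 + 1 / c3) = 1"
    using pq assms h unfolding c1_def c3_def by (simp add: divide_simps) 
  also have "emeasure lborel E0 + ennreal 1 * m = emeasure lborel (E0 \<union> S \<inter> {p..<q})"
    using S sets unfolding m_def by (subst plus_emeasure[symmetric]) (auto simp: E0_def)
  also have "E0 \<union> S \<inter> {p..<q} = S" by (auto simp: E0_def)
  finally show ?thesis .
qed

lemma zigzag_in_unit_I_iff:
  assumes "0 \<le> p" "p < u" "u < q" "q \<le> 1"
  shows "zigzag p u q x \<in> unit_I \<longleftrightarrow> x \<in> unit_I"
proof (cases "x \<in> {p..<q}")
  case True
  then have "zigzag p u q x \<in> {p..q}" by (intro zigzag_in_window assms) auto
  then show ?thesis using True assms by auto
qed (use zigzag_cases(1) assms in auto)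

lemma zigzag_ends:
  assumes "p < u" "u < q"
  shows "zigzag p u q u = p" "zigzag p u q q = q"
  using zigzag_cases(4)[OF assms, of u] zigzag_cases(1)[OF assms, of q] assms by auto

lemma zigzag_image_unit_I:
  assumes "0 \<le> p" "p < u" "u < q" "q \<le> 1"
  shows "zigzag p u q ` unit_I = unit_I"
proof
  show "unit_I \<subseteq> zigzag p u q ` unit_I"
  proof
    fix y :: real assume y: "y \<in> unit_I"
    show "y \<in> zigzag p u q ` unit_I"
    proof (cases "y \<in> {p..<q}")
      case True
      then obtain x where "u \<le> x" "x \<le> q" "zigzag p u q x = y"
        using IVT'[of "zigzag p u q" u y q] zigzag_ends[OF assms(2,3)]
          continuous_on_zigzag[OF assms(2,3)] assms by auto
      then show ?thesis using assms by (intro image_eqI[of _ _ x]) auto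
    next
      case False
      then show ?thesis using zigzag_cases(1)[OF assms(2,3) False] y by (metis imageI)
    qed
  qed
qed (use zigzag_in_unit_I_iff[OF assms] in auto)

section \<open>Perturbations inside \<open>C_lambda\<close>\<close>

text \<open>This is how functions are perturbed below: the preimage of a set under the composition is the
  preimage under the zigzag of its preimage under \<open>f\<close>, and neither step changes the measure.\<close>

lemma compose_zigzag_in_C_lambda:
  assumes f: "f \<in> C_lambda" and pq: "0 \<le> p" "p < u" "u < q" "q \<le> 1"
  shows "restrict (f \<circ> zigzag p u q) unit_I \<in> C_lambda"
proof -
  let ?z = "zigzag p u q"
  note z_iff = zigzag_in_unit_I_iff[OF pq] and z_img = zigzag_image_unit_I[OF pq]
  have cont_f: "continuous_on unit_I f" and img_f: "f ` unit_I = unit_I"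
    and leb_f: "\<And>A. A \<in> sets borel \<Longrightarrow> A \<subseteq> unit_I \<Longrightarrow>
      emeasure lborel A = emeasure lborel {x \<in> unit_I. f x \<in> A}"
    using f by (auto simp: C_lambda_def)
  have "continuous_on unit_I (f \<circ> ?z)"
    by (intro continuous_on_compose continuous_on_zigzag) (use pq z_img cont_f in auto)
  then have "continuous_on unit_I (restrict (f \<circ> ?z) unit_I)"
    by (rule continuous_on_eq) simp
  moreover have "restrict (f \<circ> ?z) unit_I ` unit_I = f ` (?z ` unit_I)"
    by (simp add: image_image)
  moreover have "emeasure lborel A = emeasure lborel {x \<in> unit_I. restrict (f \<circ> ?z) unit_I x \<in> A}"
    if A: "A \<in> sets borel" "A \<subseteq> unit_I" for A
  proof -
    have "f \<in> borel_measurable (restrict_space borel unit_I)"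
      by (rule borel_measurable_continuous_on_restrict[OF cont_f])
    from measurable_sets[OF this A(1)] have "f -` A \<inter> unit_I \<in> sets borel"
      by (simp add: sets_restrict_space_iff space_restrict_space)
    also have "f -` A \<inter> unit_I = {x \<in> unit_I. f x \<in> A}" by auto
    finally have "emeasure lborel {x. ?z x \<in> {x \<in> unit_I. f x \<in> A}} = emeasure lborel {x \<in> unit_I. f x \<in> A}"
      by (intro emeasure_lborel_zigzag_vimage pq)
    \<comment> \<open>the zigzag maps no point from outside \<open>unit_I\<close> into \<open>unit_I\<close>\<close>
    also have "{x. ?z x \<in> {x \<in> unit_I. f x \<in> A}} = {x \<in> unit_I. restrict (f \<circ> ?z) unit_I x \<in> A}"
      using z_iff by (auto simp del: atLeastAtMost_iff)
    finally show ?thesis using leb_f[OF A] by simp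
  qed
  ultimately show ?thesis by (simp add: C_lambda_def z_img img_f)
qed

lemma mdist_compose_zigzag_le:
  assumes f: "f \<in> C_lambda" and pq: "0 \<le> p" "p < u" "u < q" "q \<le> 1"
    and osc: "\<And>x y. x \<in> {p..q} \<Longrightarrow> y \<in> {p..q} \<Longrightarrow> \<bar>f x - f y\<bar> \<le> e"
  shows "mdist C_lambda_metric f (restrict (f \<circ> zigzag p u q) unit_I) \<le> e"
proof -
  have "\<bar>f x - f (zigzag p u q x)\<bar> \<le> e" if "x \<in> unit_I" for x
  proof (cases "x \<in> {p..<q}")
    case True
    then show ?thesis using pq by (intro osc zigzag_in_window) auto
  next
    case False
    then show ?thesis using zigzag_cases(1)[OF pq(2,3) False] osc[of p p] pq by auto
  qed
  then show ?thesis
    by (subst mdist_C_lambda_metric[OF f compose_zigzag_in_C_lambda[OF f pq]])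
      (auto intro!: cSUP_least)
qed

section \<open>Steep chords as an open condition\<close>

text \<open>All chords that lead from an abscissa in \<open>Y\<close> to an abscissa in \<open>X\<close> have slope greater than \<open>K\<close>,
  provided that \<open>X\<close> lies to the right of \<open>Y\<close>. Multiplying out the denominator gives the equivalent
  form in which \<open>f - K x\<close> is smaller on \<open>Y\<close> than on \<open>X\<close>, and this form is used to find steep points
  as minimisers.\<close>

definition steeper_on :: "real \<Rightarrow> (real \<Rightarrow> real) \<Rightarrow> real set \<Rightarrow> real set \<Rightarrow> bool" where
  "steeper_on K f Y X \<longleftrightarrow> (\<forall>y\<in>Y. \<forall>x\<in>X. K * (x - y) < f x - f y)"

lemma C_lambda_dist_le:
  assumes "f \<in> C_lambda" "g \<in> C_lambda" "x \<in> unit_I"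
  shows "\<bar>f x - g x\<bar> \<le> mdist C_lambda_metric f g"
proof -
  have "f x \<in> unit_I" "g x \<in> unit_I" if "x \<in> unit_I" for x
    using assms that unfolding C_lambda_def by blast+
  then have "\<bar>f x - g x\<bar> \<le> 1" if "x \<in> unit_I" for x
    using that by (smt (verit) atLeastAtMost_iff)
  then show ?thesis
    unfolding mdist_C_lambda_metric[OF assms(1,2)]
    by (intro cSUP_upper assms bdd_aboveI[where M=1]) auto
qed

lemma openin_C_lambda_iff:
  "openin (mtopology_of C_lambda_metric) U \<longleftrightarrow>
     U \<subseteq> C_lambda \<and> (\<forall>f\<in>U. \<exists>e>0. \<forall>g\<in>C_lambda. mdist C_lambda_metric f g < e \<longrightarrow> g \<in> U)"
proof -
  interpret Metric_space "mspace C_lambda_metric" "mdist C_lambda_metric" by simp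
  have "mball f e \<subseteq> U \<longleftrightarrow> (\<forall>g\<in>C_lambda. mdist C_lambda_metric f g < e \<longrightarrow> g \<in> U)"
    if "f \<in> C_lambda" for f e
    using that unfolding subset_iff in_mball unfolding mspace_C_lambda_metric by auto
  then show ?thesis
    unfolding mtopology_of_def openin_mtopology by (metis mspace_C_lambda_metric subsetD)
qed

text \<open>By compactness the strict inequality holds with a positive margin, and half of
  that margin is the radius of a ball of functions with the same property.\<close>

lemma openin_steeper_on:
  assumes "compact Y" "compact X" "Y \<subseteq> unit_I" "X \<subseteq> unit_I"
  shows "openin (mtopology_of C_lambda_metric) {f \<in> C_lambda. steeper_on K f Y X}"
  unfolding openin_C_lambda_iff
proof (intro conjI ballI)
  fix f assume "f \<in> {f \<in> C_lambda. steeper_on K f Y X}"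
  then have f: "f \<in> C_lambda" "steeper_on K f Y X" by auto
  let ?h = "\<lambda>(y, x). f x - f y - K * (x - y)"
  have cont: "continuous_on unit_I f" using f by (simp add: C_lambda_def)
  have "\<exists>d>0. \<forall>z \<in> Y \<times> X. d \<le> ?h z"
  proof (cases "Y \<times> X = {}")
    case True
    then show ?thesis by (intro exI[of _ 1]) auto
  next
    case False
    have "continuous_on (Y \<times> X) ?h"
      unfolding case_prod_beta
      by (intro continuous_intros continuous_on_compose2[OF cont]) (use assms in auto)
    then obtain z where z: "z \<in> Y \<times> X" "\<And>w. w \<in> Y \<times> X \<Longrightarrow> ?h z \<le> ?h w"
      using continuous_attains_inf[OF compact_Times[OF assms(1,2)] False] by blast
    then show ?thesis using f(2) by (intro exI[of _ "?h z"]) (auto simp: steeper_on_def)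
  qed
  then obtain d where d: "d > 0" "\<And>y x. y \<in> Y \<Longrightarrow> x \<in> X \<Longrightarrow> d \<le> f x - f y - K * (x - y)"
    by auto
  show "\<exists>e>0. \<forall>g\<in>C_lambda. mdist C_lambda_metric f g < e \<longrightarrow> g \<in> {f \<in> C_lambda. steeper_on K f Y X}"
  proof (intro exI[of _ "d / 2"] conjI ballI impI)
    fix g assume g: "g \<in> C_lambda" "mdist C_lambda_metric f g < d / 2"
    have close: "\<bar>f x - g x\<bar> < d / 2" if "x \<in> unit_I" for x
      using C_lambda_dist_le[OF f(1) g(1) that] g(2) by linarith
    have "K * (x - y) < g x - g y" if "y \<in> Y" "x \<in> X" for x y
      proof -
      have "x \<in> unit_I" "y \<in> unit_I" using that assms by auto
      then have "\<bar>f x - g x\<bar> < d / 2" "\<bar>f y - g y\<bar> < d / 2" by (intro close; simp)+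
      then show ?thesis using d(2)[OF that] by linarith
    qed
    then show "g \<in> {f \<in> C_lambda. steeper_on K f Y X}" using g by (simp add: steeper_on_def)
  qed (use d in auto)
qed auto

section \<open>Nowhere dense sets and countable covers\<close>

text \<open>An open set inside the closure of \<open>U - V\<close> misses the open set \<open>V\<close>, hence also the closure of \<open>V\<close>,
  and therefore \<open>U\<close>; but then it misses the closure of \<open>U - V\<close>.\<close>

lemma nowhere_dense_in_openin_Diff:
  assumes "openin X U" "openin X V" "U \<subseteq> X closure_of V"
  shows "nowhere_dense_in X (U - V)"
proof -
  have UV: "U - V \<subseteq> topspace X" using openin_subset[OF assms(1)] by auto
  define W where "W = X interior_of (X closure_of (U - V))"
  have W: "openin X W" "W \<subseteq> X closure_of (U - V)"
    by (simp_all add: W_def interior_of_subset)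
  have "V \<inter> X closure_of (U - V) = {}"
    using openin_Int_closure_of_eq_empty[OF assms(2), of "U - V"] by auto
  then have "W \<inter> V = {}" using W by auto
  then have "W \<inter> X closure_of V = {}"
    using openin_Int_closure_of_eq_empty[OF W(1)] by auto
  then have "W \<inter> U = {}" using assms(3) by auto
  then have "W \<inter> X closure_of (U - V) = {}"
    using openin_Int_closure_of_eq_empty[OF W(1)] by blast
  then have "W = {}" using W by auto
  then show ?thesis using UV by (simp add: nowhere_dense_in_def W_def)
qed

text \<open>Meagerness is defined by an exact union, so the covering sets have to be cut down to \<open>S\<close>.\<close>

lemma meager_in_if_countable_cover:
  assumes "countable \<F>" "\<And>A. A \<in> \<F> \<Longrightarrow> nowhere_dense_in X A" "S \<subseteq> \<Union>\<F>"
  shows "meager_in X S"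
  unfolding meager_in_def
proof (intro exI[of _ "(\<inter>) S ` \<F>"] conjI ballI)
  show "countable ((\<inter>) S ` \<F>)" using assms(1) by simp
  show "S = \<Union> ((\<inter>) S ` \<F>)" using assms(3) by auto
  fix A assume "A \<in> (\<inter>) S ` \<F>"
  then obtain B where B: "A = S \<inter> B" "B \<in> \<F>" by auto
  have "X interior_of (X closure_of A) \<subseteq> X interior_of (X closure_of B)"
    by (intro interior_of_mono closure_of_mono) (use B in auto)
  then show "nowhere_dense_in X A"
    using assms(2)[OF B(2)] B unfolding nowhere_dense_in_def by auto
qed

section \<open>Refining steep chords\<close>

text \<open>Among the minimisers the last one is chosen because beyond it \<open>h\<close> is strictly larger. Applied to
  \<open>f - K x\<close>, this finds a point all of whose chords to the right have slope greater than \<open>K\<close>.\<close>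

lemma last_minimiser:
  fixes h :: "real \<Rightarrow> real"
  assumes "a \<le> b" "continuous_on {a..b} h"
  obtains s where "s \<in> {a..b}" "\<And>x. x \<in> {a..b} \<Longrightarrow> h s \<le> h x" "\<And>x. x \<in> {s<..b} \<Longrightarrow> h s < h x"
proof -
  obtain m where m: "m \<in> {a..b}" "\<And>x. x \<in> {a..b} \<Longrightarrow> h m \<le> h x"
    using continuous_attains_inf[of "{a..b}" h] assms by auto
  define M where "M = {x \<in> {a..b}. h x = h m}"
  have "closed M"
    unfolding M_def by (rule continuous_closed_preimage_constant[OF assms(2)]) simp
  moreover have "bounded M" unfolding M_def by (rule bounded_subset[of "{a..b}"]) auto
  ultimately have "compact M" by (simp add: compact_eq_bounded_closed)
  moreover have "M \<noteq> {}" using m by (auto simp: M_def)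
  ultimately obtain s where s: "s \<in> M" "\<And>x. x \<in> M \<Longrightarrow> x \<le> s"
    using compact_attains_sup by metis
  show ?thesis
  proof
    show "s \<in> {a..b}" "\<And>x. x \<in> {a..b} \<Longrightarrow> h s \<le> h x" using s m by (auto simp: M_def)
    show "h s < h x" if "x \<in> {s<..b}" for x
    proof -
      have x: "x \<in> {a..b}" using that s(1) by (auto simp: M_def)
      have "x \<notin> M" using s(2)[of x] that by auto
      then show ?thesis using x m(2)[OF x] s(1) by (auto simp: M_def)
    qed
  qed
qed

lemma steeper_on_nearby:
  assumes cont: "continuous_on unit_I g" and "compact X" "X \<subseteq> unit_I" "s \<in> unit_I"
    and steep: "steeper_on K g {s} X"
  obtains d where "d > 0" "steeper_on K g {y \<in> unit_I. \<bar>y - s\<bar> < d} X"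
proof (cases "X = {}")
  case True
  then show ?thesis by (intro that[of 1]) (auto simp: steeper_on_def)
next
  case False
  let ?H = "\<lambda>x. g x - K * x"
  have cont_H: "continuous_on unit_I ?H" by (intro continuous_intros cont)
  obtain z where z: "z \<in> X" "\<And>x. x \<in> X \<Longrightarrow> ?H z \<le> ?H x"
    using continuous_attains_inf[OF assms(2) False continuous_on_subset[OF cont_H assms(3)]] by blast
  have "?H z - ?H s > 0"
    using steep z(1) by (auto simp: steeper_on_def algebra_simps)
  then obtain d where d: "d > 0"
    "\<And>y. y \<in> unit_I \<Longrightarrow> dist y s < d \<Longrightarrow> dist (?H y) (?H s) < ?H z - ?H s"
    using cont_H \<open>s \<in> unit_I\<close> unfolding continuous_on_iff by metis
  show ?thesis
  proof (rule that[OF d(1)])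
    have "K * (x - y) < g x - g y" if "y \<in> unit_I" "\<bar>y - s\<bar> < d" "x \<in> X" for x y
    proof -
      have "?H y < ?H z" using d(2)[of y] that by (auto simp: dist_real_def)
      also have "?H z \<le> ?H x" using z that by simp
      finally show ?thesis by (simp add: algebra_simps)
    qed
    then show "steeper_on K g {y \<in> unit_I. \<bar>y - s\<bar> < d} X" by (auto simp: steeper_on_def)
  qed
qed

text \<open>The invariant of the construction is a triple \<open>a < c < b\<close> with slope greater than \<open>K\<close> on the chords from
  \<open>a\<close> into \<open>{c..b}\<close>. A refinement is such a triple for \<open>K + 1\<close> inside \<open>{a..c}\<close>, and from all points
  of its first interval \<open>{a'..c'}\<close> the chords into \<open>{b'..b}\<close> have slope greater than \<open>K\<close>. The point at
  which a derivative will exist lies in all the intervals \<open>{a'..c'}\<close>, and the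
  successive intervals \<open>{b'..b}\<close> fill up a right neighbourhood of it.
  Between these two intervals there has to be a gap, since otherwise
  the strict inequalities would fail at a common end point and the condition would not be open.\<close>

definition refines :: "real \<Rightarrow> (real \<Rightarrow> real) \<Rightarrow> real \<times> real \<times> real \<Rightarrow> real \<times> real \<times> real \<Rightarrow> bool" where
  "refines K f = (\<lambda>(a, c, b) (a', c', b'). a \<le> a' \<and> a' < c' \<and> c' < b' \<and> b' \<le> c \<and>
     steeper_on K f {a'..c'} {b'..b} \<and> steeper_on (K + 1) f {a'} {c'..b'})"

text \<open>A single good point \<open>s\<close> suffices for a refinement: moving a little to the right of \<open>s\<close> preserves
  strict inequalities against compact sets, which leaves room for rational end points. They are
  chosen in the order \<open>b'\<close>, \<open>c'\<close>, \<open>a'\<close>, each of them close enough to \<open>s\<close> in terms of those before.\<close>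

lemma rational_refinement:
  assumes cont: "continuous_on unit_I g"
    and ord: "0 \<le> a" "a \<le> s" "s < q" "q \<le> c" "c < b" "b \<le> 1"
    and steep1: "\<And>x. x \<in> {s<..q} \<Longrightarrow> (K + 1) * (x - s) < g x - g s"
    and steep: "\<And>x. x \<in> {s<..b} \<Longrightarrow> K * (x - s) < g x - g s"
  shows "\<exists>a'\<in>\<rat>. \<exists>c'\<in>\<rat>. \<exists>b'\<in>\<rat>. refines K g (a, c, b) (a', c', b')"
proof -
  have s: "s \<in> unit_I" using ord by auto
  obtain b' where b': "b' \<in> \<rat>" "s < b'" "b' < q"
    using Rats_dense_in_real[OF ord(3)] by blast
  have "steeper_on K g {s} {b'..b}"
    using steep b' by (auto simp: steeper_on_def)
  then obtain d where d: "d > 0" "steeper_on K g {y \<in> unit_I. \<bar>y - s\<bar> < d} {b'..b}"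
    using steeper_on_nearby[OF cont _ _ s, of "{b'..b}" K] ord b' by auto
  obtain c' where c': "c' \<in> \<rat>" "s < c'" "c' < min b' (s + d)"
    using Rats_dense_in_real[of s "min b' (s + d)"] b' d by auto
  have "steeper_on (K + 1) g {s} {c'..b'}"
    using steep1 b' c' by (auto simp: steeper_on_def)
  then obtain d' where d': "d' > 0" "steeper_on (K + 1) g {y \<in> unit_I. \<bar>y - s\<bar> < d'} {c'..b'}"
    using steeper_on_nearby[OF cont _ _ s, of "{c'..b'}" "K + 1"] ord b' c' by auto
  obtain a' where a': "a' \<in> \<rat>" "s < a'" "a' < min c' (s + d')"
    using Rats_dense_in_real[of s "min c' (s + d')"] c' d' by auto
  have "steeper_on K g {a'..c'} {b'..b}"
    using d(2) a' b' c' ord by (auto simp: steeper_on_def)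
  moreover have "steeper_on (K + 1) g {a'} {c'..b'}"
    using d'(2) a' b' c' ord by (auto simp: steeper_on_def)
  ultimately have "refines K g (a, c, b) (a', c', b')"
    using a' b' c' ord by (simp add: refines_def)
  then show ?thesis using a'(1) b'(1) c'(1) by blast
qed

text \<open>Let \<open>t\<close> be the last minimiser of \<open>f - K x\<close>, and compose \<open>f\<close> with a zigzag on a window from \<open>t\<close> to \<open>q\<close> that is
  so small that \<open>f\<close> hardly varies on it. From \<open>t\<close> to \<open>q\<close> the function \<open>f - K x\<close> increases, and its
  values from \<open>q\<close> onwards exceed the value at \<open>t\<close> by some \<open>d > 0\<close>. After the composition the gain is achieved
  within the last lap from \<open>u\<close> to \<open>q\<close>, and if this lap is short compared with \<open>d\<close>, the average slope
  on it exceeds \<open>K + 1\<close>. So the last minimiser \<open>s\<close> of \<open>g - (K + 1) x\<close> on the lap is not \<open>q\<close>.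
  The shift from \<open>t\<close> to the last lap goes in the harmless direction because \<open>K \<ge> 0\<close>: it
  decreases \<open>- K x\<close>, so beyond \<open>q\<close> the chords from \<open>s\<close> still have slope greater than \<open>K\<close>.\<close>

lemma refinable_dense:
  assumes f: "f \<in> C_lambda" and ord: "0 \<le> a" "a < c" "c < b" "b \<le> 1" and "K \<ge> 0"
    and steep: "steeper_on K f {a} {c..b}" and "e > 0"
  shows "\<exists>g\<in>C_lambda. mdist C_lambda_metric f g < e \<and>
    (\<exists>a'\<in>\<rat>. \<exists>c'\<in>\<rat>. \<exists>b'\<in>\<rat>. refines K g (a, c, b) (a', c', b'))"
proof -
  have cont: "continuous_on unit_I f" using f by (simp add: C_lambda_def)
  let ?h = "\<lambda>x. f x - K * x"
  have cont_h: "continuous_on {a..b} ?h"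
    by (intro continuous_intros continuous_on_subset[OF cont]) (use ord in auto)
  obtain t where t: "t \<in> {a..b}" "\<And>x. x \<in> {a..b} \<Longrightarrow> ?h t \<le> ?h x" "\<And>x. x \<in> {t<..b} \<Longrightarrow> ?h t < ?h x"
    using last_minimiser[OF _ cont_h] ord by auto
  have "t < c"
  proof (rule ccontr)
    assume "\<not> t < c"
    then have "?h a < ?h t" using t(1) steep by (auto simp: steeper_on_def algebra_simps)
    then show False using t(2)[of a] ord by auto
  qed
  \<comment> \<open>the window: two values of \<open>f\<close> on it differ by at most \<open>e / 2\<close>\<close>
  obtain r where r: "r > 0" "\<And>x. x \<in> unit_I \<Longrightarrow> dist x t < r \<Longrightarrow> dist (f x) (f t) < e / 4"
    using cont[unfolded continuous_on_iff, rule_format, of t "e / 4"] t(1) ord \<open>e > 0\<close> by auto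
  define q where "q = min c (t + r / 2)"
  have q: "t < q" "q \<le> c" "q \<le> t + r / 2" using r \<open>t < c\<close> by (auto simp: q_def)
  obtain z where z: "z \<in> {q..b}" "\<And>x. x \<in> {q..b} \<Longrightarrow> ?h z \<le> ?h x"
    using continuous_attains_inf[of "{q..b}" ?h] continuous_on_subset[OF cont_h, of "{q..b}"]
      q ord t(1) by auto
  define d where "d = ?h z - ?h t"
  have d: "d > 0" "\<And>x. x \<in> {q..b} \<Longrightarrow> ?h t + d \<le> ?h x"
    using z t(3)[of z] q by (auto simp: d_def)
  \<comment> \<open>the second bound makes the last lap short compared with \<open>d\<close>, the first one keeps \<open>u\<close> in the window\<close>
  define u where "u = max ((t + q) / 2) (q - d / (2 * (K + 1)))"
  have "0 < d / (2 * (K + 1))" using d(1) \<open>K \<ge> 0\<close> by simp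
  then have u: "t < u" "u < q" using q(1) unfolding u_def less_max_iff_disj max_less_iff_conj by simp_all
  have "q - u \<le> d / (2 * (K + 1))" by (simp add: u_def)
  then have "(K + 1) * (q - u) \<le> d / 2" using \<open>K \<ge> 0\<close> by (simp add: field_simps)
  then have short: "(K + 1) * (q - u) < d" using d(1) by simp
  have "0 \<le> K * (q - u)" using \<open>K \<ge> 0\<close> u by simp
  then have short': "q - u < d" using short by (simp add: distrib_right)
  define g where "g = restrict (f \<circ> zigzag t u q) unit_I"
  have window: "0 \<le> t" "q \<le> 1" using t(1) q ord by auto
  have g: "g \<in> C_lambda"
    unfolding g_def by (intro compose_zigzag_in_C_lambda f window u)
  have cont_g: "continuous_on unit_I g" using g by (simp add: C_lambda_def)
  have near: "\<bar>f x - f t\<bar> < e / 4" if "x \<in> {t..q}" for x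
    using r(2)[of x] that window q r(1) by (auto simp: dist_real_def)
  have "\<bar>f x - f y\<bar> \<le> e / 2" if "x \<in> {t..q}" "y \<in> {t..q}" for x y
    using near[OF that(1)] near[OF that(2)] by linarith
  then have "mdist C_lambda_metric f g \<le> e / 2"
    unfolding g_def by (intro mdist_compose_zigzag_le f window u)
  then have close: "mdist C_lambda_metric f g < e" using \<open>e > 0\<close> by simp
  have g_u: "g u = f t" and g_right: "\<And>x. x \<in> {q..b} \<Longrightarrow> g x = f x"
    using zigzag_ends[OF u] zigzag_cases(1)[OF u] u window ord by (auto simp: g_def)
  let ?H = "\<lambda>x. g x - (K + 1) * x"
  have "continuous_on {u..q} ?H"
    by (intro continuous_intros continuous_on_subset[OF cont_g]) (use u window in auto)
  then obtain s where s: "s \<in> {u..q}" "\<And>x. x \<in> {u..q} \<Longrightarrow> ?H s \<le> ?H x"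
      "\<And>x. x \<in> {s<..q} \<Longrightarrow> ?H s < ?H x"
    using last_minimiser[of u q ?H] u by auto
  have Hs: "g s \<le> f t + (K + 1) * (s - u)"
    using s(2)[of u] u g_u by (simp add: algebra_simps)
  have "s \<noteq> q"
  proof
    assume "s = q"
    then have "f q \<le> f t + (K + 1) * (q - u)" using Hs g_right[of q] q ord by simp
    moreover have "?h t + d \<le> ?h q" using d(2)[of q] q ord by simp
    moreover have "K * t \<le> K * q" using \<open>K \<ge> 0\<close> q by (intro mult_left_mono) auto
    ultimately show False using short by linarith
  qed
  then have "s < q" using s(1) by simp
  have steep1: "(K + 1) * (x - s) < g x - g s" if "x \<in> {s<..q}" for x
    using s(3)[OF that] by (simp add: algebra_simps)
  have steep0: "K * (x - s) < g x - g s" if "x \<in> {s<..b}" for x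
  proof (cases "x \<le> q")
    case True
    then have "(K + 1) * (x - s) < g x - g s" using steep1 that by simp
    then show ?thesis using that by (simp add: distrib_right)
  next
    case False
    then have "?h t + d \<le> g x - K * x" using d(2)[of x] g_right[of x] that by simp
    moreover have "K * t \<le> K * u" using \<open>K \<ge> 0\<close> u by (intro mult_left_mono) auto
    moreover have "g s \<le> f t + (K * s - K * u) + (s - u)" using Hs by (simp add: algebra_simps)
    ultimately show ?thesis using short' s(1) by (simp add: right_diff_distrib)
  qed
  have "\<exists>a'\<in>\<rat>. \<exists>c'\<in>\<rat>. \<exists>b'\<in>\<rat>. refines K g (a, c, b) (a', c', b')"
    by (rule rational_refinement[OF cont_g, where s = s and q = q])
      (use ord t(1) s(1) u q \<open>s < q\<close> steep1 steep0 in auto)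
  then show ?thesis using g close by blast
qed

definition unrefinable :: "real \<Rightarrow> real \<times> real \<times> real \<Rightarrow> (real \<Rightarrow> real) set" where
  "unrefinable K = (\<lambda>(a, c, b). {f \<in> C_lambda. steeper_on K f {a} {c..b} \<and>
     \<not> (\<exists>a'\<in>\<rat>. \<exists>c'\<in>\<rat>. \<exists>b'\<in>\<rat>. refines K f (a, c, b) (a', c', b'))})"

text \<open>The functions that have the triple and those that have a refinement of it form open sets, and the
  latter set is dense in the former. Rationality of the refinement is what makes countably many triples
  suffice in the end.\<close>

lemma nowhere_dense_unrefinable:
  assumes ord: "0 \<le> a" "a < c" "c < b" "b \<le> 1" and "K \<ge> 0"
  shows "nowhere_dense_in (mtopology_of C_lambda_metric) (unrefinable K (a, c, b))"
proof -
  let ?X = "mtopology_of C_lambda_metric"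
  let ?U = "{f \<in> C_lambda. steeper_on K f {a} {c..b}}"
  define V where "V = {f \<in> C_lambda. \<exists>a'\<in>\<rat>. \<exists>c'\<in>\<rat>. \<exists>b'\<in>\<rat>. refines K f (a, c, b) (a', c', b')}"
  have U: "openin ?X ?U"
    using ord by (intro openin_steeper_on compact_Icc) simp_all
  have R: "openin ?X {f \<in> C_lambda. refines K f (a, c, b) (a', c', b')}" for a' c' b'
  proof (cases "a \<le> a' \<and> a' < c' \<and> c' < b' \<and> b' \<le> c")
    case True
    then have "{f \<in> C_lambda. refines K f (a, c, b) (a', c', b')} =
      {f \<in> C_lambda. steeper_on K f {a'..c'} {b'..b}} \<inter> {f \<in> C_lambda. steeper_on (K + 1) f {a'} {c'..b'}}"
      by (auto simp: refines_def)
    also have "openin ?X \<dots>"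
      using True ord by (intro openin_Int openin_steeper_on compact_Icc) simp_all
    finally show ?thesis .
  qed (auto simp: refines_def)
  have "V = (\<Union>(a', c', b')\<in>\<rat> \<times> \<rat> \<times> \<rat>. {f \<in> C_lambda. refines K f (a, c, b) (a', c', b')})"
    by (auto simp: V_def)
  also have "openin ?X \<dots>"
    using R by (intro openin_Union) auto
  finally have V: "openin ?X V" .
  have "?U \<subseteq> ?X closure_of V"
  proof
    fix f assume f: "f \<in> ?U"
    have "\<exists>g. g \<in> V \<and> g \<in> T" if T: "f \<in> T" "openin ?X T" for T
    proof -
      obtain e where e: "e > 0" "\<And>g. g \<in> C_lambda \<Longrightarrow> mdist C_lambda_metric f g < e \<Longrightarrow> g \<in> T"
        using T unfolding openin_C_lambda_iff by blast
      show ?thesis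
        using refinable_dense[OF _ ord \<open>K \<ge> 0\<close> _ e(1), of f] f e(2) by (auto simp: V_def)
    qed
    then show "f \<in> ?X closure_of V"
      using f by (auto simp: in_closure_of mspace_C_lambda_metric)
  qed
  then have "nowhere_dense_in ?X (?U - V)"
    by (rule nowhere_dense_in_openin_Diff[OF U V])
  also have "?U - V = unrefinable K (a, c, b)"
    by (auto simp: unrefinable_def V_def)
  finally show ?thesis .
qed

section \<open>Infinite right derivatives from nested refinements\<close>

lemma has_right_derivative_if_tendsto:
  assumes "0 \<le> t" "t < 1" "(diff_quotient f t \<longlongrightarrow> l) (at_right t)"
  shows "has_right_derivative f t"
proof -
  have "at t within (unit_I \<inter> {t<..}) = at_right t"
    by (rule at_within_nhd[of _ "{..<1}"]) (use assms in auto)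
  then show ?thesis
    using lim_imp_Limsup[OF _ assms(3)] lim_imp_Liminf[OF _ assms(3)]
    by (simp add: has_right_derivative_def Dini_upper_right_def Dini_lower_right_def)
qed

text \<open>The point is \<open>t = sup a n\<close>, which lies in every interval \<open>{a n..c n}\<close>. Because \<open>f\<close> takes values in
  \<open>unit_I\<close>, a chord of slope greater than \<open>n\<close> has length less than \<open>1 / n\<close>, so \<open>b n\<close> converges to \<open>t\<close>. Hence each
  \<open>x\<close> to the right of \<open>t\<close> and close to it lies in some \<open>{b (Suc n)..b n}\<close>, where \<open>n\<close> is large if \<open>x\<close>
  is close to \<open>t\<close>. The right derivative at \<open>t\<close> is therefore \<open>\<infinity>\<close>.\<close>

lemma has_right_derivative_at_nested:
  fixes a b c :: "nat \<Rightarrow> real"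
  assumes f: "f ` unit_I \<subseteq> unit_I" and ends: "0 \<le> a 0" "b 0 \<le> 1"
    and ord: "\<And>n. a n < c n" "\<And>n. c n < b n"
    and steep: "\<And>n. steeper_on (real n) f {a n} {c n..b n}"
    and ref: "\<And>n. refines (real n) f (a n, c n, b n) (a (Suc n), c (Suc n), b (Suc n))"
  shows "\<exists>t\<in>{0..<1}. has_right_derivative f t"
proof -
  have step: "a n \<le> a (Suc n)" "b (Suc n) \<le> c n"
      "steeper_on (real n) f {a (Suc n)..c (Suc n)} {b (Suc n)..b n}" for n
    using ref[of n] by (auto simp: refines_def)
  have "incseq a" using step(1) by (rule incseq_SucI)
  have "decseq b" using step(2) ord by (intro decseq_SucI) (meson less_imp_le order_trans)
  have "decseq c" using step(2) ord by (intro decseq_SucI) (meson less_imp_le order_trans)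
  have a_le_c: "a m \<le> c n" for m n
    using incseqD[OF \<open>incseq a\<close>, of m "max m n"] decseqD[OF \<open>decseq c\<close>, of n "max m n"]
      ord(1)[of "max m n"] by simp
  define t where "t = (SUP n. a n)"
  have a_le_t: "a n \<le> t" for n
    unfolding t_def using a_le_c by (intro cSUP_upper bdd_aboveI[of _ "c 0"]) auto
  have t_le_c: "t \<le> c n" for n
    unfolding t_def using a_le_c by (intro cSUP_least) auto
  have t: "0 \<le> t" "t < 1" using a_le_t[of 0] t_le_c[of 0] ord(2)[of 0] ends by auto
  have t_less_b: "t < b n" for n using t_le_c[of n] ord(2)[of n] by simp
  have in_I: "a n \<in> unit_I" "b n \<in> unit_I" for n
    using incseqD[OF \<open>incseq a\<close>, of 0 n] decseqD[OF \<open>decseq b\<close>, of 0 n] ends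
      ord[of n] by auto
  have short: "real n * (b n - t) < 1" for n
  proof -
    have "real n * (b n - t) \<le> real n * (b n - a n)"
      using a_le_t[of n] by (intro mult_left_mono) auto
    also have "\<dots> < f (b n) - f (a n)"
      using steep[of n] ord(2)[of n] by (auto simp: steeper_on_def)
    also have "\<dots> \<le> 1"
    proof -
      have "f (b n) \<in> unit_I" "f (a n) \<in> unit_I" using f in_I by blast+
      then show ?thesis by auto
    qed
    finally show ?thesis .
  qed
  have steep_t: "real N * (x - t) \<le> f x - f t" if x: "t < x" "x \<le> b N" for N x
  proof -
    obtain k where k: "1 < real k * (x - t)"
      using reals_Archimedean3[of "x - t"] x by auto
    have "b k < x"
    proof (rule ccontr)
      assume "\<not> b k < x"
      then have "real k * (x - t) \<le> real k * (b k - t)" by (intro mult_left_mono) auto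
      then show False using short[of k] k by simp
    qed
    \<comment> \<open>the first \<open>b j\<close> to the left of \<open>x\<close> determines the interval \<open>{b (Suc n)..b n}\<close> that contains \<open>x\<close>\<close>
    define j where "j = (LEAST k. b k < x)"
    have j: "b j < x" "\<And>i. i < j \<Longrightarrow> x \<le> b i"
      unfolding j_def using LeastI[of "\<lambda>k. b k < x", OF \<open>b k < x\<close>] not_less_Least by (auto simp: not_less[symmetric])
    have "N < j" using j(1) x decseqD[OF \<open>decseq b\<close>, of j N] by (cases "N < j") auto
    then obtain n where n: "j = Suc n" "N \<le> n" by (cases j) auto
    have "real n * (x - t) < f x - f t"
      using step(3)[of n] a_le_t[of "Suc n"] t_le_c[of "Suc n"] j(1) j(2)[of n] n
      by (auto simp: steeper_on_def)
    moreover have "real N * (x - t) \<le> real n * (x - t)"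
      using n x by (intro mult_right_mono) auto
    ultimately show ?thesis by simp
  qed
  have "(diff_quotient f t \<longlongrightarrow> \<infinity>) (at_right t)"
    unfolding tendsto_PInfty
  proof
    fix r :: real
    obtain N :: nat where N: "r < real N" using reals_Archimedean2 by blast
    have "ereal r < diff_quotient f t x" if "t < x" "x < b N" for x
    proof -
      have "real N \<le> (f x - f t) / (x - t)"
        using steep_t[of x N] that by (simp add: pos_le_divide_eq)
      then show ?thesis using N by (simp add: diff_quotient_def)
    qed
    then show "\<forall>\<^sub>F x in at_right t. ereal r < diff_quotient f t x"
      unfolding eventually_at_right_field using t_less_b by blast
  qed
  then show ?thesis using has_right_derivative_if_tendsto t by fastforce
qed

section \<open>Besicovitch functions cannot always be refined\<close>

text \<open>For a nonincreasing \<open>f\<close> the interval \<open>{x..1}\<close> lies between the sets where \<open>f < f x\<close> and where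
  \<open>f \<le> f x\<close>, and both of these have measure \<open>f x\<close>.\<close>

lemma nonincreasing_in_C_lambda:
  assumes f: "f \<in> C_lambda" and mono: "\<And>x y. x \<in> unit_I \<Longrightarrow> y \<in> unit_I \<Longrightarrow> x < y \<Longrightarrow> f y \<le> f x"
    and x: "x \<in> unit_I"
  shows "f x = 1 - x"
proof -
  have img: "f ` unit_I = unit_I"
    and leb: "\<And>A. A \<in> sets borel \<Longrightarrow> A \<subseteq> unit_I \<Longrightarrow>
      emeasure lborel A = emeasure lborel {x \<in> unit_I. f x \<in> A}"
    and cont: "continuous_on unit_I f"
    using f by (auto simp: C_lambda_def)
  have fI: "f z \<in> unit_I" if "z \<in> unit_I" for z using img that by blast
  have "closed {z \<in> unit_I. f z \<in> {0..f x}}"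
    using continuous_closed_preimage[OF cont, of "{0..f x}"] by (simp add: vimage_def Int_def)
  then have sets: "{z \<in> unit_I. f z \<in> {0..f x}} \<in> sets borel" by simp
  have "ennreal (1 - x) = emeasure lborel {x..1}" using x by simp
  also have "\<dots> \<le> emeasure lborel {z \<in> unit_I. f z \<in> {0..f x}}"
  proof (rule emeasure_mono)
    show "{x..1} \<subseteq> {z \<in> unit_I. f z \<in> {0..f x}}"
    proof
      fix z assume z: "z \<in> {x..1}"
      then have "z \<in> unit_I" "f z \<le> f x" using x mono[of x z] by (auto simp: le_less)
      then show "z \<in> {z \<in> unit_I. f z \<in> {0..f x}}" using fI by auto
    qed
  qed (use sets in simp)
  also have "\<dots> = emeasure lborel {0..f x}" using fI[OF x] by (subst leb) auto
  also have "\<dots> = ennreal (f x)" using fI[OF x] by simp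
  finally have "1 - x \<le> f x" using fI[OF x] by simp
  have "ennreal (f x) = emeasure lborel {0..<f x}" using fI[OF x] by simp
  also have "\<dots> = emeasure lborel {z \<in> unit_I. f z \<in> {0..<f x}}"
    using fI[OF x] by (subst leb) auto
  also have "\<dots> \<le> emeasure lborel {x..1}"
  proof (rule emeasure_mono)
    show "{z \<in> unit_I. f z \<in> {0..<f x}} \<subseteq> {x..1}"
      using mono[OF _ x] by (auto simp: not_le[symmetric]) (meson atLeastAtMost_iff not_le)
  qed simp
  also have "\<dots> = ennreal (1 - x)" using x by simp
  finally have "f x \<le> 1 - x" using x by simp
  then show ?thesis using \<open>1 - x \<le> f x\<close> by simp
qed

text \<open>The construction starts with slope 0. The only function in \<open>C_lambda\<close> without a
  rising chord is \<open>1 - x\<close>, and it is differentiable.\<close>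

lemma Besicovitch_rises:
  assumes f: "f \<in> C_lambda" and B: "Besicovitch f"
  obtains a c b where "a \<in> \<rat>" "c \<in> \<rat>" "b \<in> \<rat>" "0 \<le> a" "a < c" "c < b" "b \<le> 1"
    "steeper_on 0 f {a} {c..b}"
proof -
  have "\<exists>x\<in>unit_I. \<exists>y\<in>unit_I. x < y \<and> f x < f y"
  proof (rule ccontr)
    assume "\<not> ?thesis"
    then have lin: "f x = 1 - x" if "x \<in> unit_I" for x
      using nonincreasing_in_C_lambda[OF f _ that] by (meson not_le)
    have "diff_quotient f 0 x = ereal (- 1)" if "0 < x" "x < 1" for x
      using that lin[of x] lin[of 0] by (simp add: diff_quotient_def)
    then have "\<forall>\<^sub>F x in at_right 0. diff_quotient f 0 x = ereal (- 1)"
      unfolding eventually_at_right_field using zero_less_one by blast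
    then have "(diff_quotient f 0 \<longlongrightarrow> ereal (- 1)) (at_right 0)" by (rule tendsto_eventually)
    then have "has_right_derivative f 0" by (intro has_right_derivative_if_tendsto) auto
    then show False using B by (simp add: Besicovitch_def)
  qed
  then obtain x y where xy: "x \<in> unit_I" "y \<in> unit_I" "x < y" "f x < f y" by blast
  have cont: "continuous_on unit_I f" using f by (simp add: C_lambda_def)
  define e where "e = (f y - f x) / 2"
  have e: "e > 0" using xy by (simp add: e_def)
  obtain d where d: "d > 0" "\<And>z. z \<in> unit_I \<Longrightarrow> dist z x < d \<Longrightarrow> dist (f z) (f x) < e"
    using cont xy(1) e unfolding continuous_on_iff by metis
  obtain d' where d': "d' > 0" "\<And>z. z \<in> unit_I \<Longrightarrow> dist z y < d' \<Longrightarrow> dist (f z) (f y) < e"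
    using cont xy(2) e unfolding continuous_on_iff by metis
  obtain a where a: "a \<in> \<rat>" "x < a" "a < min y (x + d)"
    using Rats_dense_in_real[of x "min y (x + d)"] xy d by auto
  obtain c where c: "c \<in> \<rat>" "max a (y - d') < c" "c < y"
    using Rats_dense_in_real[of "max a (y - d')" y] a d' by auto
  obtain b where b: "b \<in> \<rat>" "c < b" "b < y"
    using Rats_dense_in_real[OF c(3)] by blast
  have "f a < f z" if "z \<in> {c..b}" for z
  proof -
    have "dist (f a) (f x) < e" using d(2)[of a] a xy by (auto simp: dist_real_def)
    moreover have "dist (f z) (f y) < e" using d'(2)[of z] that a b c xy by (auto simp: dist_real_def)
    moreover have "f y - f x = 2 * e" by (simp add: e_def)
    ultimately show ?thesis unfolding dist_real_def by linarith
  qed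
  then have "steeper_on 0 f {a} {c..b}" by (simp add: steeper_on_def)
  then show ?thesis using that a b c xy by auto
qed

lemma Besicovitch_unrefinable:
  assumes f: "f \<in> C_lambda" and B: "Besicovitch f"
  shows "\<exists>n::nat. \<exists>a\<in>\<rat>. \<exists>c\<in>\<rat>. \<exists>b\<in>\<rat>. 0 \<le> a \<and> a < c \<and> c < b \<and> b \<le> 1 \<and>
    f \<in> unrefinable (real n) (a, c, b)"
proof (rule ccontr)
  assume none: "\<not> ?thesis"
  define P where "P n = (\<lambda>(a, c, b). a \<in> \<rat> \<and> c \<in> \<rat> \<and> b \<in> \<rat> \<and> 0 \<le> a \<and> a < c \<and> c < b \<and> b \<le> (1::real) \<and>
    steeper_on (real n) f {a} {c..b})" for n :: nat
  have "\<exists>x. P 0 x" using Besicovitch_rises[OF f B] by (auto simp: P_def) metis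
  moreover have "\<exists>y. P (Suc n) y \<and> refines (real n) f x y" if P: "P n x" for x n
  proof -
    obtain a c b where x: "x = (a, c, b)" by (cases x)
    have "f \<notin> unrefinable (real n) (a, c, b)" using P none by (auto simp: P_def x)
    then obtain a' c' b' where r: "a' \<in> \<rat>" "c' \<in> \<rat>" "b' \<in> \<rat>" "refines (real n) f (a, c, b) (a', c', b')"
      using P f by (auto simp: unrefinable_def P_def x)
    then have "P (Suc n) (a', c', b')"
      using P by (auto simp: P_def x refines_def add.commute)
    then show ?thesis using r x by blast
  qed
  ultimately obtain s where s: "\<And>n. P n (s n)" "\<And>n. refines (real n) f (s n) (s (Suc n))"
    using dependent_nat_choice[of P "\<lambda>n. refines (real n) f"] by metis
  have "\<exists>t\<in>{0..<1}. has_right_derivative f t"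
  proof (rule has_right_derivative_at_nested)
    show "f ` unit_I \<subseteq> unit_I" using f by (simp add: C_lambda_def)
    show "refines (real n) f (fst (s n), fst (snd (s n)), snd (snd (s n)))
      (fst (s (Suc n)), fst (snd (s (Suc n))), snd (snd (s (Suc n))))" for n
      using s(2)[of n] by simp
  qed (use s(1) in \<open>auto simp: P_def case_prod_beta\<close>)
  then show False using B by (auto simp: Besicovitch_def)
qed

theorem corollary3:
  shows "meager_in (mtopology_of C_lambda_metric) {f \<in> C_lambda. Besicovitch f}"
proof (rule meager_in_if_countable_cover)
  let ?T = "{(a, c, b). a \<in> \<rat> \<and> c \<in> \<rat> \<and> b \<in> \<rat> \<and> 0 \<le> a \<and> a < c \<and> c < b \<and> b \<le> (1::real)}"
  let ?F = "(\<lambda>(n, x). unrefinable (real n) x) ` ((UNIV :: nat set) \<times> ?T)"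
  have "countable ?T"
    by (rule countable_subset[of _ "\<rat> \<times> \<rat> \<times> \<rat>"]) (auto intro: countable_rat)
  then show "countable ?F" by (intro countable_image countable_SIGMA) auto
  show "nowhere_dense_in (mtopology_of C_lambda_metric) A" if "A \<in> ?F" for A
    using that by (auto intro: nowhere_dense_unrefinable)
  show "{f \<in> C_lambda. Besicovitch f} \<subseteq> \<Union> ?F"
  proof
    fix f assume "f \<in> {f \<in> C_lambda. Besicovitch f}"
    then obtain n a c b where "(a, c, b) \<in> ?T" "f \<in> unrefinable (real n) (a, c, b)"
      using Besicovitch_unrefinable[of f] by auto
    then show "f \<in> \<Union> ?F" by (intro UN_I[of "(n, (a, c, b))"]) auto
  qed
qed

end
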